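(* Let $s,t$ be integers with $2 \leq s \leq t$. Then for $n \geq 1$, \[ \textup{ex}_{\chi \leq 3}(n, K_{s,t}) \leq \left(\frac{1}{3}\right)^{1-1/s}\left(\frac{t-1}{2} + o(1)\right)^{1/s} n^{2-1/s}, \] where $o(1)$ denotes a quantity tending to $0$ as $n \to \infty$ (with $s,t$ fixed).
   Context: For a graph $F$ and an integer $k \geq 2$, $\textup{ex}_{\chi \leq k}(n,F)$ denotes the maximum number of edges in an $n$-vertex graph $G$ that has no subgraph isomorphic to $F$ and has chromatic number at most $k$ (equivalently, $G$ is $k$-partite). $K_{s,t}$ is the complete bipartite graph with parts of sizes $s$ and $t$. *)

theory Defs
  imports Complex_Main
begin

type_synonym 'a graph = "'a set \<times> 'a set set"

abbreviation verts :: "'a graph \<Rightarrow> 'a set" where "verts \<equiv> fst"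
abbreviation edges :: "'a graph \<Rightarrow> 'a set set" where "edges \<equiv> snd"

definition simple_graph :: "'a graph \<Rightarrow> bool" where
  "simple_graph G \<longleftrightarrow> finite (verts G) \<and> (\<forall>e\<in>edges G. e \<subseteq> verts G \<and> card e = 2)"

definition subgraph :: "'a graph \<Rightarrow> 'a graph \<Rightarrow> bool" where
  "subgraph H G \<longleftrightarrow> simple_graph H \<and> verts H \<subseteq> verts G \<and> edges H \<subseteq> edges G"

definition isomorphic :: "'a graph \<Rightarrow> 'b graph \<Rightarrow> bool" where
  "isomorphic F H \<longleftrightarrow>
     (\<exists>f. bij_betw f (verts F) (verts H) \<and>
          (\<forall>u\<in>verts F. \<forall>v\<in>verts F. {u, v} \<in> edges F \<longleftrightarrow> {f u, f v} \<in> edges H))"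

definition contains_copy :: "'a graph \<Rightarrow> 'b graph \<Rightarrow> bool" where
  "contains_copy G F \<longleftrightarrow> (\<exists>H. subgraph H G \<and> isomorphic F H)"

definition proper_colouring :: "'a graph \<Rightarrow> nat \<Rightarrow> ('a \<Rightarrow> nat) \<Rightarrow> bool" where
  "proper_colouring G k c \<longleftrightarrow>
     (\<forall>v\<in>verts G. c v < k) \<and> (\<forall>u v. {u, v} \<in> edges G \<longrightarrow> c u \<noteq> c v)"

definition chromatic_number :: "'a graph \<Rightarrow> nat" where
  "chromatic_number G = (LEAST k. \<exists>c. proper_colouring G k c)"

definition complete_bipartite :: "nat \<Rightarrow> nat \<Rightarrow> (nat + nat) graph" where
  "complete_bipartite s t =
     ({..<s} <+> {..<t}, {{Inl i, Inr j} | i j. i < s \<and> j < t})"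

definition ex_chi_edge_counts :: "nat \<Rightarrow> nat \<Rightarrow> 'b graph \<Rightarrow> nat set" where
  "ex_chi_edge_counts k n F =
     {card (edges G) | G :: nat graph.
        simple_graph G \<and> card (verts G) = n \<and>
        \<not> contains_copy G F \<and> chromatic_number G \<le> k}"

text \<open>Every finite graph is isomorphic to one with vertices in \<^typ>\<open>nat\<close>, so it is no
  restriction to range over the latter. The maximum is over a finite set, which is nonempty
  whenever \<open>k \<ge> 1\<close> and \<open>F\<close> has an edge; these two facts are proved below.\<close>

definition ex_chi :: "nat \<Rightarrow> nat \<Rightarrow> 'b graph \<Rightarrow> nat" where
  "ex_chi k n F = Max (ex_chi_edge_counts k n F)"

lemma finite_ex_chi_edge_counts: "finite (ex_chi_edge_counts k n F)"
proof (rule finite_subset)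
  show "ex_chi_edge_counts k n F \<subseteq> {..2 ^ n}"
  proof
    fix m assume "m \<in> ex_chi_edge_counts k n F"
    then obtain G :: "nat graph" where G: "m = card (edges G)" "simple_graph G" "card (verts G) = n"
      unfolding ex_chi_edge_counts_def by blast
    have "edges G \<subseteq> Pow (verts G)" and fin: "finite (verts G)"
      using G(2) by (auto simp: simple_graph_def)
    then have "card (edges G) \<le> card (Pow (verts G))"
      by (intro card_mono) auto
    then show "m \<in> {..2 ^ n}"
      using G(1,3) fin by (simp add: card_Pow)
  qed
qed simp

lemma ex_chi_edge_counts_nonempty:
  assumes "k \<ge> 1" and "simple_graph F" and "edges F \<noteq> {}"
  shows "ex_chi_edge_counts k n F \<noteq> {}"
proof -
  let ?G = "({..<n}, {}) :: nat graph"
  obtain e where e: "e \<in> edges F" using assms(3) by blast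
  then obtain u v where uv: "e = {u, v}" "e \<subseteq> verts F"
    using assms(2) by (auto simp: simple_graph_def card_2_iff)
  have "\<not> contains_copy ?G F"
    using e uv by (auto simp: contains_copy_def subgraph_def isomorphic_def)
  moreover have "proper_colouring ?G 1 (\<lambda>_. 0)"
    by (simp add: proper_colouring_def)
  then have "chromatic_number ?G \<le> 1"
    unfolding chromatic_number_def by (intro Least_le) blast
  then have "chromatic_number ?G \<le> k" using assms(1) by simp
  moreover have "simple_graph ?G" by (simp add: simple_graph_def)
  moreover have "card (verts ?G) = n" by simp
  ultimately have "card (edges ?G) \<in> ex_chi_edge_counts k n F"
    unfolding ex_chi_edge_counts_def by blast
  then show ?thesis by blast
qed

lemma complete_bipartite_edge:
  assumes "s \<ge> 1" and "t \<ge> 1"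
  shows "simple_graph (complete_bipartite s t)" and "edges (complete_bipartite s t) \<noteq> {}"
proof -
  show "simple_graph (complete_bipartite s t)"
    by (auto simp: simple_graph_def complete_bipartite_def)
  have "{Inl 0, Inr 0} \<in> edges (complete_bipartite s t)"
    using assms by (force simp: complete_bipartite_def)
  then show "edges (complete_bipartite s t) \<noteq> {}" by blast
qed

end

(* Double counting pairs (v, S) with v adjacent to every vertex of an s-set S, where S is
   required to lie inside a single colour class A, gives
   sum_{v not in A} binom(d_A(v), s) <= (t - 1) binom(|A|, s), so by the power mean inequality
   e(A, V - A) <= (t - 1)^(1/s) |A| (n - |A|)^(1 - 1/s) + O(n).
   Summing over the classes counts each edge twice, and since x (n - x)^(1 - 1/s) is dominated by
   a quadratic with the same tangent at x = n/k, the sum is largest for equal classes.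
   The term O(n) is of lower order than n^(2 - 1/s) and is absorbed in epsilon. *)

theory Submission
  imports Defs "HOL-Analysis.Convex"
begin

section \<open>Power, convexity and tangent inequalities\<close>

text \<open>The right side is the falling factorial of \<open>d\<close> with \<open>s\<close>
  factors; if \<open>d \<ge> s\<close>, each factor is at least \<open>d - s\<close>. Truncated
  subtraction makes the left side 0 when \<open>d < s\<close>. This trades binomials for pure powers
  at the cost of a shift by \<open>s\<close>.\<close>

lemma falling_power_le_fact_binomial: "(d - s) ^ s \<le> fact s * (d choose s)"
proof (induction s arbitrary: d)
  case (Suc s)
  have "(d - Suc s) ^ Suc s = (d - Suc s) * (d - 1 - s) ^ s" by simp
  also have "\<dots> \<le> d * (fact s * (d - 1 choose s))"
    by (intro mult_mono Suc.IH) auto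
  also have "\<dots> = fact s * (Suc s * (d choose Suc s))"
    by (simp only: binomial_absorption mult.left_commute)
  also have "\<dots> = fact (Suc s) * (d choose Suc s)"
    by (simp add: algebra_simps)
  finally show ?case .
qed simp

text \<open>The power mean inequality: Jensen for \<open>x ^ s\<close> on the half-line with equal
  weights, cleared of denominators.\<close>

lemma power_sum_le_sum_power:
  fixes y :: "'a \<Rightarrow> real"
  assumes "finite I" and "\<And>i. i \<in> I \<Longrightarrow> 0 \<le> y i" and "1 \<le> s"
  shows "(\<Sum>i\<in>I. y i) ^ s \<le> real (card I) ^ (s - 1) * (\<Sum>i\<in>I. y i ^ s)"
proof (cases "I = {}")
  case True
  then show ?thesis using assms(3) by (simp add: power_0_left)
next
  case False
  let ?N = "real (card I)"
  have N: "?N > 0" using False assms(1) by (simp add: card_gt_0_iff)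
  have "convex_on {0::real..} (\<lambda>x. x ^ s)"
    using convex_power_even[of s] convex_power_odd[of s]
    by (cases "even s") (auto intro: convex_on_subset)
  from convex_on_sum[OF assms(1) False this, of "\<lambda>_. 1 / ?N" y]
  have "((\<Sum>i\<in>I. y i) / ?N) ^ s \<le> (\<Sum>i\<in>I. y i ^ s) / ?N"
    using assms False N by (simp add: sum_divide_distrib)
  then have "(\<Sum>i\<in>I. y i) ^ s \<le> (\<Sum>i\<in>I. y i ^ s) / ?N * ?N ^ s"
    using N by (simp add: power_divide pos_divide_le_eq)
  also have "?N ^ s = ?N * ?N ^ (s - 1)"
    using assms(3) by (metis power_minus_mult mult.commute less_eq_Suc_le One_nat_def)
  finally show ?thesis using N by (simp add: mult_ac)
qed

text \<open>Positivity of \<open>m\<close> covers \<open>x = 0\<close>, where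
  \<open>0 ^ 0 = 1\<close> but \<open>0 powr 0 = 0\<close>.\<close>

lemma power_powr_divide:
  fixes x :: real
  assumes "0 \<le> x" and "0 < m"
  shows "(x ^ m) powr (1 / real s) = x powr (real m / real s)"
  using assms by (cases "x = 0") (simp_all add: powr_powr flip: powr_realpow)

text \<open>By concavity, \<open>x powr p\<close> lies below its tangent at \<open>c\<close>. This
  is weighted AM-GM for the numbers \<open>x / c\<close> and 1.\<close>

lemma powr_le_tangent:
  fixes x c p :: real
  assumes "0 \<le> x" and "0 < c" and "0 < p" and "p \<le> 1"
  shows "x powr p \<le> c powr p * (1 - p + p * (x / c))"
proof (cases "x = 0")
  case False
  then have "(x / c) powr p * 1 powr (1 - p) \<le> p * (x / c) + (1 - p) * 1"
    using assms by (intro Youngs_inequality_0) auto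
  then have "x powr p / c powr p \<le> 1 - p + p * (x / c)"
    using assms by (simp add: powr_divide)
  then show ?thesis using assms by (simp add: pos_divide_le_eq mult.commute)
qed (use assms in auto)

text \<open>Replacing each \<open>powr\<close> by its tangent leaves a bound increasing in the sum
  of \<open>a i * (n - a i)\<close>, and Cauchy-Schwarz shows that this sum is at most its value for
  equal \<open>a i\<close>.\<close>

lemma sum_mult_powr_complement_le:
  fixes a :: "nat \<Rightarrow> real" and n p :: real
  assumes "2 \<le> k" and "0 < n" and "0 < p" and "p \<le> 1"
    and a: "\<And>i. i < k \<Longrightarrow> 0 \<le> a i" and sum_a: "(\<Sum>i<k. a i) = n"
  shows "(\<Sum>i<k. a i * (n - a i) powr p) \<le> n * (n * (1 - 1 / real k)) powr p"
proof -
  \<comment> \<open>The common value of \<open>n - a i\<close> when all \<open>a i\<close> equal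
    \<open>n / k\<close>; tangency there makes the bound exact for equal classes.\<close>
  define c where "c = n * (1 - 1 / real k)"
  have c: "0 < c" using assms(1,2) by (simp add: c_def)
  have a_le: "a i \<le> n" if "i < k" for i
    unfolding sum_a[symmetric] using that a by (intro member_le_sum) auto
  have squares: "n\<^sup>2 / k \<le> (\<Sum>i<k. (a i)\<^sup>2)"
    using sum_squared_le_sum_of_squares[of a "{..<k}"] assms(1)
    by (simp add: sum_a pos_divide_le_eq)
  have "(\<Sum>i<k. a i * (n - a i)) = n * n - (\<Sum>i<k. (a i)\<^sup>2)"
    unfolding right_diff_distrib sum_subtractf power2_eq_square
    by (simp add: sum_distrib_right[symmetric] sum_a)
  also have "\<dots> \<le> n * c"
    using squares by (simp add: c_def right_diff_distrib power2_eq_square)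
  finally have products: "(\<Sum>i<k. a i * (n - a i)) \<le> n * c" .
  have expand: "x * (b * (1 - p + p * (w / c))) = b * (1 - p) * x + b * (p / c) * (x * w)"
    for x b w :: real
    by (simp add: algebra_simps)
  have "(\<Sum>i<k. a i * (n - a i) powr p)
      \<le> (\<Sum>i<k. a i * (c powr p * (1 - p + p * ((n - a i) / c))))"
    using a a_le c assms(3,4) by (intro sum_mono mult_left_mono powr_le_tangent) auto
  also have "\<dots> = (\<Sum>i<k. c powr p * (1 - p) * a i + c powr p * (p / c) * (a i * (n - a i)))"
    by (simp only: expand)
  also have "\<dots> = c powr p * (1 - p) * n + c powr p * (p / c) * (\<Sum>i<k. a i * (n - a i))"
    by (simp only: sum.distrib sum_distrib_left[symmetric] sum_a)
  also have "\<dots> \<le> c powr p * (1 - p) * n + c powr p * (p / c) * (n * c)"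
    using products assms(3) c by (intro add_left_mono mult_left_mono) auto
  also have "\<dots> = n * c powr p"
  proof -
    have "c powr p * (p / c) * (n * c) = c powr p * p * n" using c by simp
    then show ?thesis by (simp add: algebra_simps)
  qed
  finally show ?thesis by (simp add: c_def)
qed

section \<open>Colourings and degree sums of simple graphs\<close>

lemma simple_graph_no_loop: "simple_graph G \<Longrightarrow> {v} \<notin> edges G"
  by (auto simp: simple_graph_def)

lemma finite_edges: "simple_graph G \<Longrightarrow> finite (edges G)"
  by (rule finite_subset[of _ "Pow (verts G)"]) (auto simp: simple_graph_def)

text \<open>The \<open>LEAST\<close> is attained once some proper colouring exists; as vertices are
  natural numbers, the identity is one, with any strict upper bound of the vertices as number of
  colours.\<close>

lemma proper_colouring_chromatic_number:
  fixes G :: "nat graph"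
  assumes "simple_graph G"
  shows "\<exists>c. proper_colouring G (chromatic_number G) c"
proof -
  have "finite (verts G)" using assms by (simp add: simple_graph_def)
  then obtain m where "\<forall>v\<in>verts G. v < m"
    unfolding finite_nat_set_iff_bounded by blast
  moreover have "u \<noteq> v" if "{u, v} \<in> edges G" for u v
    using simple_graph_no_loop[OF assms, of v] that by auto
  ultimately have "proper_colouring G m id"
    unfolding proper_colouring_def id_apply by blast
  then have "\<exists>k c. proper_colouring G k c" by blast
  then show ?thesis
    unfolding chromatic_number_def by (rule LeastI_ex)
qed

text \<open>Neighbours \<open>u\<close> of \<open>v\<close> correspond to edges through
  \<open>v\<close> by \<open>u \<mapsto> {u, v}\<close>, and every edge passes through two
  vertices.\<close>

lemma handshake:
  assumes "simple_graph G"
  shows "(\<Sum>v\<in>verts G. card {u \<in> verts G. {u, v} \<in> edges G}) = 2 * card (edges G)"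
proof -
  have "card {u \<in> verts G. {u, v} \<in> edges G} = card {e \<in> edges G. v \<in> e}" for v
  proof (rule bij_betw_same_card[of "\<lambda>u. {u, v}"])
    have "e \<in> (\<lambda>u. {u, v}) ` {u \<in> verts G. {u, v} \<in> edges G}" if e: "e \<in> edges G" "v \<in> e" for e
    proof -
      have "card e = 2" "e \<subseteq> verts G" using assms e by (auto simp: simple_graph_def)
      then obtain u where "e = {u, v}" "u \<in> verts G"
        using e(2) by (auto simp: card_2_iff insert_commute)
      then show ?thesis using e by auto
    qed
    then show "bij_betw (\<lambda>u. {u, v}) {u \<in> verts G. {u, v} \<in> edges G} {e \<in> edges G. v \<in> e}"
      by (auto simp: bij_betw_def inj_on_def doubleton_eq_iff)
  qed
  then have "(\<Sum>v\<in>verts G. card {u \<in> verts G. {u, v} \<in> edges G})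
      = (\<Sum>v\<in>verts G. card {e \<in> edges G. v \<in> e})"
    by simp
  also have "\<dots> = 2 * card (edges G)"
  proof (rule sum_multicount)
    show "\<forall>e\<in>edges G. card {v \<in> verts G. v \<in> e} = 2"
    proof
      fix e assume "e \<in> edges G"
      then have "{v \<in> verts G. v \<in> e} = e" "card e = 2"
        using assms by (auto simp: simple_graph_def)
      then show "card {v \<in> verts G. v \<in> e} = 2" by simp
    qed
  qed (use assms finite_edges[OF assms] in \<open>auto simp: simple_graph_def\<close>)
  finally show ?thesis .
qed

section \<open>Complete bipartite subgraphs and double counting\<close>

lemma contains_complete_bipartiteI:
  assumes "simple_graph G" and "card S = s" and "card T = t" and "finite S" and "finite T"
    and S: "S \<subseteq> verts G" and T: "T \<subseteq> verts G"
    and ST: "\<And>u v. u \<in> S \<Longrightarrow> v \<in> T \<Longrightarrow> {u, v} \<in> edges G"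
  shows "contains_copy G (complete_bipartite s t)"
proof -
  have disjoint: "S \<inter> T = {}"
    using ST simple_graph_no_loop[OF assms(1)] by fastforce
  obtain g where g: "bij_betw g {..<s} S"
    using ex_bij_betw_nat_finite[OF assms(4)] assms(2) by (auto simp: atLeast0LessThan)
  obtain h where h: "bij_betw h {..<t} T"
    using ex_bij_betw_nat_finite[OF assms(5)] assms(3) by (auto simp: atLeast0LessThan)
  define f where "f = case_sum g h"
  \<comment> \<open>Only the cross edges are kept: \<open>G\<close> may have edges inside
    \<open>S\<close> or \<open>T\<close>, while \<open>isomorphic\<close> requires non-edges to
    correspond as well.\<close>
  define H where "H = (S \<union> T, {{u, v} | u v. u \<in> S \<and> v \<in> T})"
  have "card e = 2" if e: "e \<in> edges H" for e
  proof -
    obtain u v where "e = {u, v}" "u \<in> S" "v \<in> T" using e by (auto simp: H_def)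
    moreover from this disjoint have "u \<noteq> v" by blast
    ultimately show ?thesis by simp
  qed
  then have "subgraph H G"
    using assms by (auto simp: subgraph_def simple_graph_def H_def)
  moreover have "isomorphic (complete_bipartite s t) H"
    unfolding isomorphic_def
  proof (intro exI conjI ballI)
    have gS: "g i \<in> S" if "i < s" for i using g that by (auto simp: bij_betw_def)
    have hT: "h j \<in> T" if "j < t" for j using h that by (auto simp: bij_betw_def)
    have gh: "g i \<noteq> h j" if "i < s" "j < t" for i j
      using gS[OF that(1)] hT[OF that(2)] disjoint by auto
    have "inj_on f ({..<s} <+> {..<t})"
      using g h gh gh[symmetric] by (auto simp: f_def inj_on_def bij_betw_def)
    moreover have "f ` ({..<s} <+> {..<t}) = S \<union> T"
      using g h by (simp add: f_def Plus_def image_Un image_image bij_betw_def)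
    ultimately show "bij_betw f (verts (complete_bipartite s t)) (verts H)"
      by (simp add: bij_betw_def complete_bipartite_def H_def)
    fix u v
    assume "u \<in> verts (complete_bipartite s t)" "v \<in> verts (complete_bipartite s t)"
    then show "{u, v} \<in> edges (complete_bipartite s t) \<longleftrightarrow> {f u, f v} \<in> edges H"
    proof (cases u; cases v)
      \<comment> \<open>Two vertices on the same side: neither graph has the edge, because every
        edge of \<open>H\<close> has an end in \<open>T\<close>, which disjointness keeps away from
        \<open>S\<close>.\<close>
      fix i i' assume "u = Inl i" "v = Inl i'"
      moreover from this gS have "g i \<notin> T" "g i' \<notin> T"
        using disjoint \<open>u \<in> _\<close> \<open>v \<in> _\<close> by (auto simp: complete_bipartite_def)
      ultimately show ?thesis
        by (auto simp: complete_bipartite_def f_def H_def doubleton_eq_iff)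
    next
      fix j j' assume "u = Inr j" "v = Inr j'"
      moreover from this hT have "h j \<notin> S" "h j' \<notin> S"
        using disjoint \<open>u \<in> _\<close> \<open>v \<in> _\<close> by (auto simp: complete_bipartite_def)
      ultimately show ?thesis
        by (auto simp: complete_bipartite_def f_def H_def doubleton_eq_iff)
    qed (use gS hT in \<open>auto simp: complete_bipartite_def f_def H_def doubleton_eq_iff\<close>)
  qed
  ultimately show ?thesis unfolding contains_copy_def by blast
qed

text \<open>Any \<open>t\<close> common neighbours would serve as the second side of a copy with
  first side \<open>S\<close>.\<close>

lemma card_common_neighbours_le:
  assumes "simple_graph G" and "\<not> contains_copy G (complete_bipartite s t)"
    and "S \<subseteq> verts G" and "card S = s"
  shows "card {v \<in> verts G. \<forall>u\<in>S. {u, v} \<in> edges G} \<le> t - 1"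
proof (rule ccontr)
  let ?N = "{v \<in> verts G. \<forall>u\<in>S. {u, v} \<in> edges G}"
  assume "\<not> card ?N \<le> t - 1"
  then have "t \<le> card ?N" by simp
  then obtain T where "T \<subseteq> ?N" "card T = t" "finite T"
    by (rule obtain_subset_with_card_n)
  moreover have "finite S"
    using finite_subset[OF assms(3)] assms(1) by (simp add: simple_graph_def)
  ultimately have "contains_copy G (complete_bipartite s t)"
    using assms(1,3,4) by (intro contains_complete_bipartiteI[of G S s T t]) auto
  with assms(2) show False ..
qed

text \<open>The double count of pairs of a vertex \<open>v\<close> in \<open>B\<close> and an
  \<open>s\<close>-subset of its neighbourhood in \<open>A\<close>. Only \<open>s\<close>-subsets of
  \<open>A\<close> occur, hence \<open>card A\<close> on the right instead of the number of all
  vertices.\<close>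

lemma sum_binomial_degree_le:
  assumes "simple_graph G" and "\<not> contains_copy G (complete_bipartite s t)"
    and "A \<subseteq> verts G" and "B \<subseteq> verts G"
  shows "(\<Sum>v\<in>B. card {u \<in> A. {u, v} \<in> edges G} choose s) \<le> (t - 1) * (card A choose s)"
proof -
  have fin: "finite A" "finite B"
    using finite_subset[OF assms(3)] finite_subset[OF assms(4)] assms(1)
    by (simp_all add: simple_graph_def)
  let ?\<S> = "{S. S \<subseteq> A \<and> card S = s}"
  have "(card {u \<in> A. {u, v} \<in> edges G} choose s)
      = card {S \<in> ?\<S>. \<forall>u\<in>S. {u, v} \<in> edges G}" for v
  proof -
    have "{S. S \<subseteq> {u \<in> A. {u, v} \<in> edges G} \<and> card S = s}
        = {S \<in> ?\<S>. \<forall>u\<in>S. {u, v} \<in> edges G}" by auto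
    then show ?thesis
      using n_subsets[of "{u \<in> A. {u, v} \<in> edges G}" s] fin by simp
  qed
  then have "(\<Sum>v\<in>B. card {u \<in> A. {u, v} \<in> edges G} choose s)
      = (\<Sum>v\<in>B. card {S \<in> ?\<S>. \<forall>u\<in>S. {u, v} \<in> edges G})"
    by simp
  also have "\<dots> = (\<Sum>S\<in>?\<S>. card {v \<in> B. \<forall>u\<in>S. {u, v} \<in> edges G})"
    using fin by (intro sum_multicount_gen) auto
  also have "\<dots> \<le> (\<Sum>S\<in>?\<S>. t - 1)"
  proof (rule sum_mono)
    fix S assume "S \<in> ?\<S>"
    then have "card {v \<in> verts G. \<forall>u\<in>S. {u, v} \<in> edges G} \<le> t - 1"
      using assms by (intro card_common_neighbours_le) auto
    moreover have "card {v \<in> B. \<forall>u\<in>S. {u, v} \<in> edges G}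
        \<le> card {v \<in> verts G. \<forall>u\<in>S. {u, v} \<in> edges G}"
      using assms by (intro card_mono) (auto simp: simple_graph_def)
    ultimately show "card {v \<in> B. \<forall>u\<in>S. {u, v} \<in> edges G} \<le> t - 1" by simp
  qed
  also have "\<dots> = (t - 1) * (card A choose s)"
    using n_subsets[OF fin(1), of s] by simp
  finally show ?thesis .
qed

text \<open>The power mean inequality over \<open>B\<close> turns the double count into a bound on
  the degree sum after taking \<open>s\<close>-th roots. The term \<open>s * card B\<close> pays for
  the shift from binomials to powers.\<close>

lemma sum_degree_into_le:
  assumes "simple_graph G" and "\<not> contains_copy G (complete_bipartite s t)"
    and "A \<subseteq> verts G" and "B \<subseteq> verts G" and "2 \<le> s" and "1 \<le> t"
  shows "real (\<Sum>v\<in>B. card {u \<in> A. {u, v} \<in> edges G})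
    \<le> real s * real (card B)
      + (real t - 1) powr (1 / real s) * real (card A) * real (card B) powr (1 - 1 / real s)"
proof -
  define d where "d v = card {u \<in> A. {u, v} \<in> edges G}" for v
  \<comment> \<open>The subtraction is truncated before the cast, so \<open>y v\<close> is
    nonnegative and \<open>d v \<le> s + y v\<close> holds for small degrees too.\<close>
  define y where "y v = real (d v - s)" for v
  define Y where "Y = (\<Sum>v\<in>B. y v)"
  have finB: "finite B"
    using finite_subset[OF assms(4)] assms(1) by (simp add: simple_graph_def)
  have "(\<Sum>v\<in>B. (d v - s) ^ s) \<le> (\<Sum>v\<in>B. fact s * (d v choose s))"
    by (intro sum_mono falling_power_le_fact_binomial)
  also have "\<dots> = fact s * (\<Sum>v\<in>B. d v choose s)"
    by (rule sum_distrib_left[symmetric])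
  also have "\<dots> \<le> fact s * ((t - 1) * (card A choose s))"
    unfolding d_def by (rule mult_left_mono[OF sum_binomial_degree_le[OF assms(1-4)]]) simp
  \<comment> \<open>The factor \<open>fact s\<close> is absorbed here:
    \<open>fact s * (card A choose s)\<close> is at most \<open>card A ^ s\<close>.\<close>
  also have "\<dots> \<le> (t - 1) * card A ^ s"
    using binomial_fact_pow[of "card A" s] by (simp add: mult_ac)
  finally have "real (\<Sum>v\<in>B. (d v - s) ^ s) \<le> real ((t - 1) * card A ^ s)"
    by (rule of_nat_mono)
  then have powers: "(\<Sum>v\<in>B. y v ^ s) \<le> (real t - 1) * real (card A) ^ s"
    using assms(6) by (simp add: y_def)
  have "Y ^ s \<le> real (card B) ^ (s - 1) * (\<Sum>v\<in>B. y v ^ s)"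
    unfolding Y_def using finB assms(5) by (intro power_sum_le_sum_power) (auto simp: y_def)
  also have "\<dots> \<le> real (card B) ^ (s - 1) * ((real t - 1) * real (card A) ^ s)"
    by (intro mult_left_mono powers) auto
  finally have "(Y ^ s) powr (1 / real s)
      \<le> (real (card B) ^ (s - 1) * ((real t - 1) * real (card A) ^ s)) powr (1 / real s)"
    by (intro powr_mono2) (auto simp: Y_def y_def sum_nonneg)
  also have "\<dots> = (real (card B) ^ (s - 1)) powr (1 / real s)
      * ((real t - 1) powr (1 / real s) * (real (card A) ^ s) powr (1 / real s))"
    using assms(6) by (simp add: powr_mult)
  also have "(Y ^ s) powr (1 / real s) = Y"
    using assms(5) by (subst power_powr_divide) (auto simp: Y_def y_def sum_nonneg)
  also have "(real (card A) ^ s) powr (1 / real s) = real (card A)"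
    using assms(5) by (subst power_powr_divide) auto
  also have "(real (card B) ^ (s - 1)) powr (1 / real s) = real (card B) powr (1 - 1 / real s)"
    using assms(5) by (subst power_powr_divide) (auto simp: diff_divide_distrib)
  finally have Y: "Y \<le> (real t - 1) powr (1 / real s) * real (card A)
      * real (card B) powr (1 - 1 / real s)"
    by (simp add: mult_ac)
  have "real (\<Sum>v\<in>B. d v) \<le> (\<Sum>v\<in>B. real s + y v)"
    unfolding of_nat_sum by (intro sum_mono) (simp add: y_def)
  also have "\<dots> = real s * real (card B) + Y"
    by (simp add: sum.distrib Y_def)
  finally show ?thesis using Y by (simp add: d_def)
qed

section \<open>Summation over the colour classes\<close>

text \<open>The degree bound is applied to each class \<open>A i\<close> against its complement. The
  linear errors add up to \<open>s * (k - 1) * n\<close>, since the complements have total size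
  \<open>(k - 1) * n\<close>.\<close>

lemma card_edges_le_of_proper_colouring:
  assumes G: "simple_graph G" and free: "\<not> contains_copy G (complete_bipartite s t)"
    and c: "proper_colouring G k c" and n: "card (verts G) = n"
    and "2 \<le> k" and "1 \<le> n" and "2 \<le> s" and "1 \<le> t"
  shows "2 * real (card (edges G)) \<le> real s * real (k - 1) * real n
    + (real t - 1) powr (1 / real s) * real n * (real n * (1 - 1 / real k)) powr (1 - 1 / real s)"
proof -
  define p where "p = 1 - 1 / real s"
  define A where "A i = {v \<in> verts G. c v = i}" for i
  define a where "a i = real (card (A i))" for i
  have fin: "finite (verts G)" using G by (simp add: simple_graph_def)
  have disjoint_cover: "(\<Sum>i<k. card {v \<in> X. c v = i}) = card X" if "X \<subseteq> verts G" for X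
  proof -
    have "finite X" "c ` X \<subseteq> {..<k}"
      using finite_subset[OF that fin] that c by (auto simp: proper_colouring_def)
    then show ?thesis
      using sum.group[of X "{..<k}" c "\<lambda>_. 1::nat"] by simp
  qed
  have sum_a: "(\<Sum>i<k. a i) = real n"
    using disjoint_cover[of "verts G"] n by (simp add: a_def A_def flip: of_nat_sum)
  have card_compl: "real (card (verts G - A i)) = real n - a i" for i
    unfolding a_def n[symmetric]
    by (subst card_Diff_subset) (auto simp: A_def fin card_mono)
  \<comment> \<open>A vertex has no neighbour in its own class, so only \<open>n - a i\<close>
    vertices enter the power mean; this is where the colouring improves the constant.\<close>
  have inside: "(\<Sum>v\<in>verts G. card {u \<in> A i. {u, v} \<in> edges G})
      = (\<Sum>v\<in>verts G - A i. card {u \<in> A i. {u, v} \<in> edges G})" for i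
  proof (rule sum.mono_neutral_right)
    show "\<forall>v\<in>verts G - (verts G - A i). card {u \<in> A i. {u, v} \<in> edges G} = 0"
    proof
      fix v assume "v \<in> verts G - (verts G - A i)"
      then have "{u \<in> A i. {u, v} \<in> edges G} = {}"
        using c by (force simp: A_def proper_colouring_def)
      then show "card {u \<in> A i. {u, v} \<in> edges G} = 0"
        by (metis card.empty)
    qed
  qed (use fin in auto)
  have "2 * card (edges G) = (\<Sum>v\<in>verts G. card {u \<in> verts G. {u, v} \<in> edges G})"
    using handshake[OF G] by simp
  also have "\<dots> = (\<Sum>v\<in>verts G. \<Sum>i<k. card {u \<in> A i. {u, v} \<in> edges G})"
  proof (rule sum.cong[OF refl])
    fix v
    have "{u \<in> A i. {u, v} \<in> edges G} = {u \<in> {u \<in> verts G. {u, v} \<in> edges G}. c u = i}" for i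
      by (auto simp: A_def)
    then show "card {u \<in> verts G. {u, v} \<in> edges G} = (\<Sum>i<k. card {u \<in> A i. {u, v} \<in> edges G})"
      using disjoint_cover[of "{u \<in> verts G. {u, v} \<in> edges G}"] by simp
  qed
  also have "\<dots> = (\<Sum>i<k. \<Sum>v\<in>verts G - A i. card {u \<in> A i. {u, v} \<in> edges G})"
    by (subst sum.swap) (simp add: inside)
  finally have "2 * real (card (edges G))
      = (\<Sum>i<k. real (\<Sum>v\<in>verts G - A i. card {u \<in> A i. {u, v} \<in> edges G}))"
    by (simp flip: of_nat_sum)
  also have "\<dots> \<le> (\<Sum>i<k. real s * (real n - a i)
      + (real t - 1) powr (1 / real s) * a i * (real n - a i) powr p)"
    \<comment> \<open>\<open>real n - a i\<close> is folded back into the size of the complement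
      while \<open>a\<close> is still opaque, so that the goal matches
      \<open>sum_degree_into_le\<close>.\<close>
    unfolding card_compl[symmetric] p_def unfolding a_def
    using assms by (intro sum_mono sum_degree_into_le) (auto simp: A_def)
  also have "\<dots> = real s * (real k * real n - real n)
      + (real t - 1) powr (1 / real s) * (\<Sum>i<k. a i * (real n - a i) powr p)"
    by (simp add: sum.distrib sum_subtractf sum_a mult.assoc flip: sum_distrib_left)
  also have "\<dots> \<le> real s * (real k * real n - real n)
      + (real t - 1) powr (1 / real s) * (real n * (real n * (1 - 1 / real k)) powr p)"
    using assms sum_a
    by (intro add_left_mono mult_left_mono sum_mult_powr_complement_le) (auto simp: a_def p_def)
  finally show ?thesis
    using \<open>2 \<le> k\<close> by (simp add: p_def algebra_simps)
qed

section \<open>Three colours and the vanishing error term\<close>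

text \<open>The maximum is attained by some graph, to which the edge bound with \<open>k = 3\<close>
  applies. Halving it gives the stated constant because \<open>2 powr p / 2\<close> is
  \<open>1 / 2 powr (1 / s)\<close>, which moves the 2 under \<open>t - 1\<close>.\<close>

lemma ex_chi_3_le:
  assumes "2 \<le> s" and "1 \<le> t" and "1 \<le> n"
  shows "real (ex_chi 3 n (complete_bipartite s t)) \<le> real s * real n
    + (1 / 3) powr (1 - 1 / real s) * ((real t - 1) / 2) powr (1 / real s)
      * real n powr (2 - 1 / real s)"
proof -
  let ?X = "ex_chi_edge_counts 3 n (complete_bipartite s t)"
  define p where "p = 1 - 1 / real s"
  have "?X \<noteq> {}"
    using complete_bipartite_edge[of s t] assms by (intro ex_chi_edge_counts_nonempty) auto
  then have "ex_chi 3 n (complete_bipartite s t) \<in> ?X"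
    unfolding ex_chi_def by (intro Max_in finite_ex_chi_edge_counts)
  then obtain G :: "nat graph" where G: "ex_chi 3 n (complete_bipartite s t) = card (edges G)"
      "simple_graph G" "card (verts G) = n" "\<not> contains_copy G (complete_bipartite s t)"
      "chromatic_number G \<le> 3"
    unfolding ex_chi_edge_counts_def by blast
  obtain c where "proper_colouring G (chromatic_number G) c"
    using proper_colouring_chromatic_number[OF G(2)] by blast
  \<comment> \<open>A colouring with at most three colours is also a colouring with colour bound
    3.\<close>
  then have "proper_colouring G 3 c"
    using G(5) by (auto simp: proper_colouring_def)
  from card_edges_le_of_proper_colouring[OF G(2,4) this G(3)] assms
  have "2 * real (card (edges G)) \<le> 2 * (real s * real n)
      + (real t - 1) powr (1 / real s) * (real n * (real n * (2 / 3)) powr p)"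
    by (simp add: p_def mult_ac)
  also have "real n * (real n * (2 / 3)) powr p = (2 * (1 / 3)) powr p * real n powr (1 + p)"
    using assms powr_mult[of "real n" "2 / 3" p] by (simp add: powr_add)
  also have "(2 * (1 / 3)) powr p = 2 powr p * (1 / 3 :: real) powr p"
    by (rule powr_mult)
  also have "2 powr p = 2 / 2 powr (1 / real s)"
    by (simp add: p_def powr_diff)
  finally show ?thesis
    using assms by (simp add: G(1) p_def powr_divide mult_ac)
qed

theorem theorem1:
  fixes s t :: nat
  assumes "2 \<le> s" and "s \<le> t"
  shows "\<exists>\<epsilon> :: nat \<Rightarrow> real. \<epsilon> \<longlonglongrightarrow> 0 \<and>
    (\<forall>n\<ge>1. 0 \<le> (real t - 1) / 2 + \<epsilon> n \<and>
      real (ex_chi 3 n (complete_bipartite s t))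
        \<le> (1 / 3) powr (1 - 1 / real s)
          * ((real t - 1) / 2 + \<epsilon> n) powr (1 / real s)
          * real n powr (2 - 1 / real s))"
proof -
  define p where "p = 1 - 1 / real s"
  define q where "q = (real t - 1) / 2"
  \<comment> \<open>Chosen so that \<open>(1 / 3) powr p * r n * n powr (1 + p)\<close> equals the
    bound of \<open>ex_chi_3_le\<close> for \<open>n \<ge> 1\<close>: the second summand contributes
    exactly \<open>s * n\<close>.\<close>
  define r where "r n = q powr (1 / real s) + real s * 3 powr p * real n powr (- p)" for n
  have p: "0 < p" and q: "0 \<le> q" using assms by (auto simp: p_def q_def)
  have r: "0 \<le> r n" for n by (simp add: r_def)
  have root: "(x powr (1 / real s)) ^ s = x" if "0 \<le> x" for x
    using that assms(1) by (cases "x = 0") (auto simp: powr_power)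
  \<comment> \<open>The linear term is of lower order because \<open>p > 0\<close>; hence
    \<open>r n\<close> tends to the \<open>s\<close>-th root of \<open>q\<close> and
    \<open>r n ^ s\<close> to \<open>q\<close>.\<close>
  have "(\<lambda>n. real n powr (- p)) \<longlonglongrightarrow> 0"
    using p by (intro tendsto_neg_powr filterlim_real_sequentially) auto
  then have "(\<lambda>n. r n ^ s - q) \<longlonglongrightarrow> (q powr (1 / real s) + real s * 3 powr p * 0) ^ s - q"
    unfolding r_def by (intro tendsto_intros)
  then have "(\<lambda>n. r n ^ s - q) \<longlonglongrightarrow> 0"
    by (simp add: root q)
  moreover have "real (ex_chi 3 n (complete_bipartite s t))
      \<le> (1 / 3) powr p * (r n ^ s) powr (1 / real s) * real n powr (1 + p)" if "1 \<le> n" for n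
  proof -
    have "(1 / 3) powr p * r n * real n powr (1 + p)
        = real s * real n * ((1 / 3) powr p * 3 powr p) * (real n powr p * real n powr (- p))
          + (1 / 3) powr p * q powr (1 / real s) * real n powr (1 + p)"
      using that by (simp add: r_def powr_add algebra_simps)
    also have "(1 / 3) powr p * 3 powr p = (1 :: real)"
      by (simp add: powr_divide)
    also have "real n powr p * real n powr (- p) = 1"
      using that by (simp flip: powr_add)
    finally have "real (ex_chi 3 n (complete_bipartite s t))
        \<le> (1 / 3) powr p * r n * real n powr (1 + p)"
      using ex_chi_3_le[of s t n] assms that by (simp add: p_def q_def)
    moreover have "(r n ^ s) powr (1 / real s) = r n"
      using r[of n] assms(1) by (subst power_powr_divide) auto
    ultimately show ?thesis by simp
  qed
  ultimately show ?thesis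
    \<comment> \<open>With this error, \<open>q + \<epsilon> n\<close> is \<open>r n ^ s\<close>: it
      is nonnegative and its \<open>s\<close>-th root is \<open>r n\<close>. The exponent
      \<open>1 + p\<close> is \<open>2 - 1 / s\<close>.\<close>
    using r by (intro exI[of _ "\<lambda>n. r n ^ s - q"]) (auto simp: p_def q_def)
qed

end
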